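(* Let $k\ge 1$ and $n\ge 0$ be integers. The total number of $k$-Motzkin paths of size $n$ is given by $$|\mathtt{Mot}(n;k)|=\frac{1}{n+1}\sum_{j=0}^{\lfloor n/k\rfloor}\binom{n+1}{n-kj}\binom{n-kj}{j}.$$
   Context: A $k$-Motzkin path of size $n$ is a lattice path from $(0,0)$ to $(n,0)$ which stays in the first quadrant (it never goes below the line $y=0$) and in which each step is either an up step $U=(1,k)$, a down step $D=(1,-1)$ or a horizontal step $H=(1,0)$. The set of such paths is denoted $\mathtt{Mot}(n;k)$. Here $\binom{a}{b}=0$ when $b>a\ge 0$. *)

theory Defs
  imports Complex_Main "HOL-Library.Product_Plus"
begin

datatype step = U | D | H

fun step_vec :: "nat \<Rightarrow> step \<Rightarrow> int \<times> int" where
  "step_vec k U = (1, int k)"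
| "step_vec k D = (1, -1)"
| "step_vec k H = (1, 0)"

text \<open>A lattice path starting at the origin is encoded by its sequence of steps;
  vertex \<open>k p i\<close> is the lattice point reached after the first \<open>i\<close> steps.\<close>

definition vertex :: "nat \<Rightarrow> step list \<Rightarrow> nat \<Rightarrow> int \<times> int" where
  "vertex k p i = (\<Sum>s\<leftarrow>take i p. step_vec k s)"

text \<open>The first quadrant is convex, so a path stays in it iff all its vertices do.\<close>

definition Mot :: "nat \<Rightarrow> nat \<Rightarrow> step list set" where
  "Mot n k = {p. vertex k p (length p) = (int n, 0) \<and>
     (\<forall>i\<le>length p. 0 \<le> fst (vertex k p i) \<and> 0 \<le> snd (vertex k p i))}"

end

theory Submission
  imports Defs "HOL-Computational_Algebra.Polynomial"
begin

text \<open>Let \<open>N(m, s)\<close> be the number of words of length \<open>m\<close> in the steps with total height \<open>-s\<close>.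
  Summing the heights of the letters of all these words gives
  \<open>s N(m+1, s) = (m+1) (N(m, s-1) - k N(m, s+k))\<close>. Induction on the first step then yields the
  ballot formula \<open>(m+1) g(m, h) = (h+1) N(m+1, h+1)\<close> for the number \<open>g(m, h)\<close> of nonnegative
  paths of length \<open>m\<close> from height \<open>h\<close> to \<open>0\<close>. Raising all heights by one,
  \<open>N(m, s)\<close> is the coefficient of \<open>x\<close> to the \<open>m - s\<close> in the \<open>m\<close>-th power of \<open>1 + x (1 + x^k)\<close>.\<close>

fun words :: "nat \<Rightarrow> nat \<Rightarrow> int \<Rightarrow> int" where
  "words k 0 s = (if s = 0 then 1 else 0)"
| "words k (Suc m) s = words k m (s + int k) + words k m s + words k m (s - 1)"

text \<open>Count descents by position: at each of the \<open>Suc m\<close> places a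
  \<open>D\<close> weighs 1 and leaves a word counted by \<open>words k m (s - 1)\<close>, a
  \<open>U\<close> weighs \<open>- int k\<close> and leaves one counted by
  \<open>words k m (s + int k)\<close>, and an \<open>H\<close> weighs 0.\<close>

lemma words_weighted:
  "s * words k (Suc m) s = int (Suc m) * (words k m (s - 1) - int k * words k m (s + int k))"
proof (induction m arbitrary: s)
  case 0
  then show ?case by (auto simp: algebra_simps)
next
  case (Suc m)
  let ?w = "words k (Suc m)"
  \<comment> \<open>Splitting off the first letter, the weight \<open>s\<close> is read as
    \<open>(s + int k) - int k\<close> for \<open>U\<close> and as \<open>(s - 1) + 1\<close> for
    \<open>D\<close>; the first parts fit the induction hypothesis.\<close>
  have "s * words k (Suc (Suc m)) s =
      (s + int k) * ?w (s + int k) + s * ?w s + (s - 1) * ?w (s - 1)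
      + (?w (s - 1) - int k * ?w (s + int k))"
    by (subst words.simps(2)) (simp only: algebra_simps)
  also have "(s + int k) * ?w (s + int k) + s * ?w s + (s - 1) * ?w (s - 1)
      = int (Suc m) * (?w (s - 1) - int k * ?w (s + int k))"
    unfolding Suc.IH by (simp add: algebra_simps)
  finally show ?case by (simp only: of_nat_Suc algebra_simps)
qed

text \<open>After the shift, \<open>U\<close>, \<open>H\<close> and \<open>D\<close> carry the
  exponents \<open>Suc k\<close>, 1 and 0. The case \<open>s > int m\<close> is set apart because
  \<open>nat\<close> would send the negative exponent to 0, where the coefficient is 1.\<close>

lemma words_eq_coeff:
  "words k m s = (if s \<le> int m
     then coeff ((1 + monom 1 1 * (1 + monom 1 k)) ^ m) (nat (int m - s)) else 0)"
proof (induction m arbitrary: s)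
  case 0
  then show ?case by (auto simp: coeff_1)
next
  case (Suc m)
  let ?q = "(1 + monom 1 1 * (1 + monom 1 k)) ^ m :: int poly"
  have eq: "(1 + monom 1 1 * (1 + monom 1 k)) ^ Suc m
      = ?q + monom 1 1 * ?q + monom 1 (Suc k) * ?q"
    by (simp add: algebra_simps mult_monom)
  have c: "coeff (monom 1 a * ?q) t = (if t < a then 0 else coeff ?q (t - a))" for a t
    by (simp add: coeff_monom_mult)
  have n: "nat (int m - (s - 1)) = nat (int (Suc m) - s)"
    "nat (int m - s) = nat (int (Suc m) - s) - 1"
    "nat (int m - (s + int k)) = nat (int (Suc m) - s) - Suc k"
    by auto
  show ?case
    unfolding words.simps(2) Suc.IH eq coeff_add c n by auto
qed

text \<open>Let \<open>i\<close> of the \<open>m\<close> factors contribute x (1 + x^k), and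
  \<open>j\<close> of these x^k. The exponent is then \<open>i + k * j\<close>, so \<open>j\<close>
  determines \<open>i\<close>, and \<open>n \<le> m\<close> keeps this \<open>i\<close> in
  range.\<close>

lemma coeff_trinomial_power:
  assumes "k \<ge> 1" "n \<le> m"
  shows "coeff ((1 + monom 1 1 * (1 + monom 1 k)) ^ m :: int poly) n
    = (\<Sum>j = 0..n div k. int (m choose (n - k * j)) * int ((n - k * j) choose j))"
proof -
  have binom: "(1 + monom 1 k) ^ i = (\<Sum>j\<le>i. of_nat (i choose j) * monom (1::int) (k * j))" for i
    using binomial_ring[of "monom (1::int) k" 1 i] by (simp add: monom_power add.commute)
  have "(1 + monom 1 1 * (1 + monom 1 k)) ^ m =
      (\<Sum>i\<le>m. of_nat (m choose i) * (monom (1::int) i * (1 + monom 1 k) ^ i))"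
    using binomial_ring[of "monom (1::int) 1 * (1 + monom 1 k)" 1 m]
    by (simp add: monom_power power_mult_distrib add.commute)
  also have "\<dots> = (\<Sum>i\<le>m. \<Sum>j\<le>i. monom (int (m choose i) * int (i choose j)) (i + k * j))"
    unfolding binom sum_distrib_left
    by (intro sum.cong refl) (simp add: of_nat_monom mult_monom)
  finally have "coeff ((1 + monom 1 1 * (1 + monom 1 k)) ^ m :: int poly) n =
      (\<Sum>i\<le>m. \<Sum>j\<le>i. if i + k * j = n then int (m choose i) * int (i choose j) else 0)"
    by (simp add: coeff_sum)
  also have "\<dots> = (\<Sum>i\<le>m. \<Sum>j = 0..n div k.
      if i + k * j = n then int (m choose i) * int (i choose j) else 0)"
  \<comment> \<open>The inner range becomes independent of \<open>i\<close>: indices dropped have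
    \<open>k * j > n\<close>, and indices added have \<open>j > i\<close>, where the binomial
    vanishes.\<close>
  proof (rule sum.cong[OF refl], rule sum.mono_neutral_cong)
    fix i j assume "j \<in> {..i} - {0..n div k}"
    then have "n div k < j" by auto
    then have "n < k * j" using \<open>k \<ge> 1\<close> by (simp add: div_less_iff_less_mult mult.commute)
    then show "(if i + k * j = n then int (m choose i) * int (i choose j) else 0) = 0" by simp
  qed (auto simp: binomial_eq_0)
  also have "\<dots> = (\<Sum>j = 0..n div k. \<Sum>i\<le>m.
      if i + k * j = n then int (m choose i) * int (i choose j) else 0)"
    by (rule sum.swap)
  also have "\<dots> = (\<Sum>j = 0..n div k. int (m choose (n - k * j)) * int ((n - k * j) choose j))"
  proof (intro sum.cong refl)
    fix j assume "j \<in> {0..n div k}"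
    then have "k * j \<le> n" using \<open>k \<ge> 1\<close>
      by (simp add: less_eq_div_iff_mult_less_eq mult.commute)
    then have "i + k * j = n \<longleftrightarrow> i = n - k * j" for i by auto
    then show "(\<Sum>i\<le>m. if i + k * j = n then int (m choose i) * int (i choose j) else 0)
        = int (m choose (n - k * j)) * int ((n - k * j) choose j)"
      using \<open>n \<le> m\<close> by (simp add: le_diff_conv trans_le_add1)
  qed
  finally show ?thesis .
qed

text \<open>The free starting height \<open>h\<close> is what makes a recursion on the first step
  possible.\<close>

fun nonneg_path :: "nat \<Rightarrow> int \<Rightarrow> step list \<Rightarrow> bool" where
  "nonneg_path k h [] \<longleftrightarrow> h = 0"
| "nonneg_path k h (s # p) \<longleftrightarrow> 0 \<le> h \<and> nonneg_path k (h + snd (step_vec k s)) p"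

lemma vertex_0 [simp]: "vertex k p 0 = 0"
  by (simp add: vertex_def)

lemma vertex_Cons_Suc [simp]: "vertex k (s # p) (Suc i) = step_vec k s + vertex k p i"
  by (simp add: vertex_def)

lemma fst_vertex: "i \<le> length p \<Longrightarrow> fst (vertex k p i) = int i"
proof (induction p arbitrary: i)
  case (Cons s p)
  then show ?case by (cases s; cases i) auto
qed simp

lemma nonneg_path_iff:
  "nonneg_path k h p \<longleftrightarrow> h + snd (vertex k p (length p)) = 0 \<and>
     (\<forall>i\<le>length p. 0 \<le> h + snd (vertex k p i))"
proof (induction p arbitrary: h)
  case (Cons s p)
  have "(\<forall>i\<le>length (s # p). 0 \<le> h + snd (vertex k (s # p) i)) \<longleftrightarrow>
      0 \<le> h \<and> (\<forall>i\<le>length p. 0 \<le> h + snd (step_vec k s) + snd (vertex k p i))"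
    by (auto simp: All_less_Suc2 less_Suc_eq_le[symmetric] add.assoc)
  then show ?case
    by (auto simp: Cons.IH add.assoc)
qed auto

text \<open>Every step advances by one, so the abscissa of the end point is the length.\<close>

lemma Mot_eq: "Mot n k = {p. length p = n \<and> nonneg_path k 0 p}"
proof -
  have "vertex k p (length p) = (int n, 0) \<longleftrightarrow>
      length p = n \<and> snd (vertex k p (length p)) = 0" for p
    using fst_vertex[of "length p" p k] by (auto simp: prod_eq_iff)
  then show ?thesis
    by (auto simp: Mot_def nonneg_path_iff fst_vertex)
qed

definition num_paths :: "nat \<Rightarrow> nat \<Rightarrow> int \<Rightarrow> nat" where
  "num_paths k m h = card {p. length p = m \<and> nonneg_path k h p}"

lemma finite_paths: "finite {p. length p = m \<and> nonneg_path k h p}"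
proof (rule finite_subset)
  show "{p. length p = m \<and> nonneg_path k h p} \<subseteq> {p. set p \<subseteq> {U, D, H} \<and> length p = m}"
    using step.exhaust by blast
  show "finite {p. set p \<subseteq> {U, D, H} \<and> length p = m}"
    by (rule finite_lists_length_eq) simp
qed

lemma nonneg_path_neg: "h < 0 \<Longrightarrow> \<not> nonneg_path k h p"
  by (cases p) auto

lemma num_paths_neg: "h < 0 \<Longrightarrow> num_paths k m h = 0"
  by (simp add: num_paths_def nonneg_path_neg)

lemma num_paths_0: "num_paths k 0 h = (if h = 0 then 1 else 0)"
proof -
  have "{p. length p = 0 \<and> nonneg_path k h p} = (if h = 0 then {[]} else {})"
    by auto
  then show ?thesis by (simp add: num_paths_def)
qed

lemma num_paths_Suc:
  assumes "0 \<le> h"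
  shows "num_paths k (Suc m) h =
    num_paths k m (h + int k) + num_paths k m h + num_paths k m (h - 1)"
proof -
  let ?P = "\<lambda>h. {p. length p = m \<and> nonneg_path k h p}"
  have "{p. length p = Suc m \<and> nonneg_path k h p} =
      (#) U ` ?P (h + int k) \<union> (#) H ` ?P h \<union> (#) D ` ?P (h - 1)" (is "?L = ?R")
  proof (intro equalityI subsetI)
    fix p assume "p \<in> ?L"
    then obtain s q where "p = s # q" by (auto simp: length_Suc_conv)
    with \<open>p \<in> ?L\<close> show "p \<in> ?R" by (cases s) auto
  qed (use assms in auto)
  moreover have "card \<dots> =
      card (?P (h + int k)) + card (?P h) + card (?P (h - 1))"
    by (subst card_Un_disjoint; (subst card_Un_disjoint)?)
       (auto simp: finite_paths card_image)
  ultimately show ?thesis by (simp add: num_paths_def)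
qed

text \<open>Both sides vanish at \<open>h = -1\<close>; admitting this boundary value lets the
  induction hypothesis cover a \<open>D\<close> step from height 0.\<close>

lemma ballot:
  assumes "-1 \<le> h"
  shows "int (Suc m) * int (num_paths k m h) = (h + 1) * words k (Suc m) (h + 1)"
  using assms
proof (induction m arbitrary: h)
  case 0
  then show ?case by (auto simp: num_paths_0)
next
  case (Suc m)
  show ?case
  proof (cases "h = -1")
    case True
    then show ?thesis by (simp add: num_paths_neg)
  next
    case False
    with Suc.prems have "0 \<le> h" by simp
    let ?w = "words k (Suc m)" and ?s = "h + 1"
    define W where "W = ?s * words k (Suc (Suc m)) ?s"
    have W: "W = int (Suc (Suc m)) * (?w h - int k * ?w (?s + int k))"
      using words_weighted[of ?s k "Suc m"] by (simp only: W_def add_diff_cancel_right')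
    have "int (Suc m) * int (num_paths k (Suc m) h) =
        (h + int k + 1) * ?w (h + int k + 1) + ?s * ?w ?s + h * ?w h"
      using Suc.IH[of "h + int k"] Suc.IH[of h] Suc.IH[of "h - 1"] \<open>0 \<le> h\<close>
      by (simp only: num_paths_Suc of_nat_add distrib_left diff_add_cancel)
    \<comment> \<open>Again the weight \<open>?s\<close> is split over the first letter. By
      \<open>W\<close> the subtracted bracket is the fraction 1/(m+2) of \<open>W\<close>, so
      multiplying by m+2 leaves (m+1) \<open>W\<close>, and m+1 cancels.\<close>
    also have "\<dots> = W - (?w h - int k * ?w (?s + int k))"
      unfolding W_def words.simps(2)[of k "Suc m" ?s] add_diff_cancel_right'
      by (simp only: algebra_simps)
    finally have "int (Suc (Suc m)) * (int (Suc m) * int (num_paths k (Suc m) h)) =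
        int (Suc m) * W"
      by (simp only: W) (simp only: of_nat_Suc algebra_simps)
    then have "int (Suc m) * (int (Suc (Suc m)) * int (num_paths k (Suc m) h)) =
        int (Suc m) * W"
      by (simp only: ac_simps)
    then show ?thesis
      unfolding W_def by (simp only: mult_cancel_left) simp
  qed
qed

theorem proposition4p22:
  fixes k n :: nat
  assumes "k \<ge> 1"
  shows "real (card (Mot n k)) =
    1 / (real n + 1) *
      (\<Sum>j = 0..n div k. real ((n + 1) choose (n - k * j)) * real ((n - k * j) choose j))"
proof -
  \<comment> \<open>At height 0 the ballot factor is 1 and \<open>s = 1\<close>, so the exponent to
    extract is (n+1) - 1 = n.\<close>
  have "int (Suc n) * int (card (Mot n k)) = words k (Suc n) 1"
    using ballot[of 0 n k] by (simp only: Mot_eq num_paths_def) simp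
  also have "\<dots> = coeff ((1 + monom 1 1 * (1 + monom 1 k)) ^ Suc n) n"
    by (simp only: words_eq_coeff) simp
  also have "\<dots> = (\<Sum>j = 0..n div k. int (Suc n choose (n - k * j)) * int ((n - k * j) choose j))"
    by (rule coeff_trinomial_power) (use assms in auto)
  finally have "int (Suc n * card (Mot n k)) =
      int (\<Sum>j = 0..n div k. (Suc n choose (n - k * j)) * ((n - k * j) choose j))"
    by (simp only: of_nat_mult of_nat_sum)
  then have "real (Suc n * card (Mot n k)) =
      real (\<Sum>j = 0..n div k. (Suc n choose (n - k * j)) * ((n - k * j) choose j))"
    by (simp only: of_nat_eq_iff)
  then show ?thesis
    by (simp add: field_simps)
qed

end
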